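(* Let $N\geq 2$, let $D$ be a domain in $\mathbb{R}^N$, and let $K\geq 1$. Let $\varphi :[0,+\infty ]\rightarrow [0,+\infty ]$ and $\psi :[0,+\infty ]\rightarrow [0,+\infty ]$ be increasing functions for which there are $s_0, s_1\in \mathbb{N}$, $s_0<s_1$, such that (i) the inverse functions $\varphi^{-1}$ and $\psi^{-1}$ are defined on $[\min\{\varphi(s_1-s_0),\psi(s_1-s_0)\},+\infty]$, (ii) $2K(\psi^{-1}\circ\varphi)(s-s_0)\leq (\psi^{-1}\circ\varphi)(s)$ for all $s\geq s_1$, (iii) the following integral is convergent: $$\int_{s_1}^{+\infty}\left[\frac{(\psi^{-1}\circ\varphi)(s+2)}{(\psi^{-1}\circ\varphi)(s)}\cdot\frac{1}{\varphi(s-s_0)}\right]^{\frac{1}{N-1}}ds<+\infty.$$ Let $\mathcal{F}_K$ be a family of $K$-quasinearly subharmonic functions $u:D\rightarrow[-\infty,+\infty)$ such that $u(x)\leq F_K(x)$ for all $x\in D$ (for every $u\in\mathcal{F}_K$), where $F_K:D\rightarrow[0,+\infty]$ is a Lebesgue measurable function. If for each compact set $E\subset D$, $$\int_E\psi(F_K(x))\,dm_N(x)<+\infty,$$ then the family $\mathcal{F}_K$ is locally (uniformly) bounded in $D$. Moreover, the function $w^*:D\rightarrow[0,+\infty)$ is $K$-quasinearly subharmonic. Here $$w^*(x):=\limsup_{y\rightarrow x}w(y),\qquad w(x):=\sup_{u\in\mathcal{F}_K}u^+(x).$$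
   Context: $B^N(x,r)$ is the open Euclidean ball in $\mathbb{R}^N$ with center $x$ and radius $r$, $m_N$ is Lebesgue measure on $\mathbb{R}^N$, $\nu_N$ is the Lebesgue measure of the unit ball of $\mathbb{R}^N$, and $u^+=\max\{u,0\}$. The function $w^*$ is the upper semicontinuous regularization of $w$. Definition. Let $K\ge 1$. A Lebesgue measurable function $u:D\rightarrow[-\infty,+\infty)$ is $K$-quasinearly subharmonic if $u^+\in\mathcal{L}^1_{\mathrm{loc}}(D)$ and, for all balls $\overline{B^N(x,r)}\subset D$ and all $M\geq 0$, $$u_M(x)\leq\frac{K}{\nu_N r^N}\int_{B^N(x,r)}u_M(y)\,dm_N(y),\qquad u_M:=\max\{u,-M\}+M.$$ *)

theory Defs
  imports "HOL-Analysis.Analysis"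
begin

text \<open>Functions with values in \<open>[-\<infinity>, +\<infinity>]\<close> have type \<^typ>\<open>ereal\<close>, functions with values in
  \<open>[0, +\<infinity>]\<close> have type \<^typ>\<open>ennreal\<close>. Only the values of a function on \<open>D\<close> matter.\<close>

definition domain_in :: "(real ^ 'n) set \<Rightarrow> bool" where
  "domain_in D \<longleftrightarrow> open D \<and> connected D \<and> D \<noteq> {}"

definition pos_part :: "('a \<Rightarrow> ereal) \<Rightarrow> 'a \<Rightarrow> ennreal" where
  "pos_part u x = e2ennreal (max (u x) 0)"

text \<open>The function \<open>u\<^sub>M = max {u, -M} + M\<close>. It is nonnegative for \<open>M \<ge> 0\<close>, so the conversion to
  \<^typ>\<open>ennreal\<close> loses nothing.\<close>

definition lower_trunc :: "('a \<Rightarrow> ereal) \<Rightarrow> real \<Rightarrow> 'a \<Rightarrow> ennreal" where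
  "lower_trunc u M x = e2ennreal (max (u x) (- ereal M) + ereal M)"

definition locally_integrable_on :: "(real ^ 'n \<Rightarrow> ennreal) \<Rightarrow> (real ^ 'n) set \<Rightarrow> bool" where
  "locally_integrable_on g D \<longleftrightarrow>
     g \<in> borel_measurable (lebesgue_on D) \<and>
     (\<forall>E. compact E \<and> E \<subseteq> D \<longrightarrow> (\<integral>\<^sup>+ x\<in>E. g x \<partial>lebesgue) < \<infinity>)"

definition quasinearly_subharmonic ::
    "real \<Rightarrow> (real ^ 'n) set \<Rightarrow> (real ^ 'n \<Rightarrow> ereal) \<Rightarrow> bool" where
  "quasinearly_subharmonic K D u \<longleftrightarrow>
     (\<forall>x\<in>D. u x < \<infinity>) \<and>
     u \<in> borel_measurable (lebesgue_on D) \<and>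
     locally_integrable_on (pos_part u) D \<and>
     (\<forall>x r M. r > 0 \<and> cball x r \<subseteq> D \<and> M \<ge> 0 \<longrightarrow>
        lower_trunc u M x \<le>
          ennreal (K / (measure lebesgue (ball (0 :: real ^ 'n) 1) * r ^ CARD('n))) *
          (\<integral>\<^sup>+ y\<in>ball x r. lower_trunc u M y \<partial>lebesgue))"

text \<open>Functions in a family may take the value \<open>-\<infinity>\<close> and need not have a common lower bound (the
  negative constants are an example), so boundedness is boundedness from above.\<close>

definition locally_uniformly_bounded ::
    "(real ^ 'n) set \<Rightarrow> (real ^ 'n \<Rightarrow> ereal) set \<Rightarrow> bool" where
  "locally_uniformly_bounded D \<F> \<longleftrightarrow>
     (\<forall>x\<in>D. \<exists>r>0. \<exists>C::real. ball x r \<subseteq> D \<and> (\<forall>u\<in>\<F>. \<forall>y\<in>ball x r. u y \<le> ereal C))"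

text \<open>The upper limit is taken over all points of \<open>D\<close> near \<open>x\<close>, including \<open>x\<close> itself.\<close>

definition usc_regularization ::
    "(real ^ 'n) set \<Rightarrow> (real ^ 'n \<Rightarrow> ennreal) \<Rightarrow> real ^ 'n \<Rightarrow> ennreal" where
  "usc_regularization D w x = Limsup (inf (nhds x) (principal D)) w"

text \<open>\<open>h\<inverse>\<close> is defined on \<open>A\<close>: every point of \<open>A\<close> has exactly one preimage, so that \<open>inv h\<close> is the
  inverse function there.\<close>

definition inverse_defined_on :: "(ennreal \<Rightarrow> ennreal) \<Rightarrow> ennreal set \<Rightarrow> bool" where
  "inverse_defined_on h A \<longleftrightarrow> (\<forall>t\<in>A. \<exists>!s. h s = t)"

text \<open>Power of an element of \<open>[0, +\<infinity>]\<close> to a positive exponent.\<close>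

definition ennreal_powr :: "ennreal \<Rightarrow> real \<Rightarrow> ennreal" where
  "ennreal_powr x p = (if x = \<infinity> then \<infinity> else ennreal (enn2real x powr p))"

end

theory Submission
  imports Defs
begin

text \<open>Domar's iteration. Put \<open>g = \<psi>\<inverse> \<circ> \<phi>\<close> and let \<open>u(y) > g(j)\<close>. If \<open>u \<le> g(j + 1)\<close> on a ball \<open>B(y, R)\<close>, then
  splitting the mean value inequality at the level \<open>g(j - s\<^sub>0)\<close>, whose contribution is at most
  \<open>g(j) / 2\<close> by (ii), shows that \<open>R\<^sup>N\<close> is bounded by a multiple of \<open>g(j + 1) / g(j)\<close> times the measure of
  \<open>A\<^sub>j = {g(j - s\<^sub>0) \<le> u \<le> g(j + 1)}\<close>. So for slightly larger radii \<open>R\<^sub>j\<close> one can walk through points at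
  which \<open>u\<close> exceeds \<open>g(j)\<close>, \<open>g(j + 1)\<close>, and so on. Every point lies in at most \<open>s\<^sub>0 + 2\<close> of the sets \<open>A\<^sub>j\<close>, and
  \<open>\<psi>(F) \<ge> \<phi>(j - s\<^sub>0)\<close> on \<open>A\<^sub>j\<close>, so \<open>\<Sum> \<phi>(j - s\<^sub>0) m(A\<^sub>j)\<close> is bounded uniformly in \<open>u\<close>; together with (iii) this
  makes the tails of \<open>\<Sum> R\<^sub>j\<close> uniformly small. The walk then stays in a compact ball, on which the
  single function \<open>u\<close> is bounded by its own mean value inequality: a contradiction if it starts
  above a high level near the centre.\<close>

section \<open>Domar's iteration\<close>

text \<open>The defining inequality at M = 0, for functions with values in [0, \<infinity>].
  Measurability and integrability are kept apart and supplied where they matter.\<close>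

definition sub_mean_value :: "real \<Rightarrow> (real ^ 'n) set \<Rightarrow> (real ^ 'n \<Rightarrow> ennreal) \<Rightarrow> bool" where
  "sub_mean_value K D v \<longleftrightarrow>
     (\<forall>x r. r > 0 \<and> cball x r \<subseteq> D \<longrightarrow>
        v x \<le> ennreal (K / (measure lebesgue (ball (0 :: real ^ 'n) 1) * r ^ CARD('n))) *
          (\<integral>\<^sup>+ y\<in>ball x r. v y \<partial>lebesgue))"

lemma sub_mean_valueD:
  fixes x :: "real ^ 'n"
  assumes "sub_mean_value K D v" "r > 0" "cball x r \<subseteq> D"
  shows "v x \<le> ennreal (K / (measure lebesgue (ball (0 :: real ^ 'n) 1) * r ^ CARD('n))) *
          (\<integral>\<^sup>+ y\<in>ball x r. v y \<partial>lebesgue)"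
  using assms unfolding sub_mean_value_def by blast

lemma measure_unit_ball_pos: "measure lebesgue (ball (0 :: real ^ 'n) 1) > 0"
  by (simp add: content_ball_pos measure_completion)

lemma emeasure_ball_cart:
  fixes x :: "real ^ 'n"
  assumes "r \<ge> 0"
  shows "emeasure lebesgue (ball x r) = ennreal (measure lebesgue (ball (0 :: real ^ 'n) 1) * r ^ CARD('n))"
proof -
  have "emeasure lebesgue (ball (0 :: real ^ 'n) 1) = ennreal (measure lebesgue (ball (0 :: real ^ 'n) 1))"
    by (rule emeasure_eq_measure2) simp
  then have "emeasure lebesgue (ball x r) = ennreal (r ^ CARD('n)) * ennreal (measure lebesgue (ball (0 :: real ^ 'n) 1))"
    using emeasure_lebesgue_ball_conv_unit_ball[OF assms, of x] by (simp only: DIM_cart DIM_real mult_1_right)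
  also have "\<dots> = ennreal (r ^ CARD('n) * measure lebesgue (ball (0 :: real ^ 'n) 1))"
    using assms by (intro ennreal_mult'[symmetric]) simp
  finally show ?thesis by (simp only: mult.commute)
qed

text \<open>If \<open>v\<close> stayed below \<open>hi\<close> on the ball, values below
  \<open>lo\<close> would contribute at most \<open>K * lo \<le> g / 2\<close> to the mean value
  bound, and \<open>A\<close> at most \<open>g / 2\<close> by \<open>big\<close>, against
  \<open>g < v y0\<close>. The set \<open>A\<close> is taken in \<open>E\<close> and not in the
  ball, so it does not depend on \<open>y0\<close>, which the iteration finds only as it
  proceeds.\<close>

lemma sub_mean_value_step:
  fixes v :: "real ^ 'n \<Rightarrow> ennreal" and y0 :: "real ^ 'n" and E :: "(real ^ 'n) set" and lo hi :: real
  defines "\<nu> \<equiv> measure lebesgue (ball (0 :: real ^ 'n) 1)"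
    and "A \<equiv> {y\<in>E. ennreal lo \<le> v y \<and> v y \<le> ennreal hi}"
  assumes mv: "sub_mean_value K D v" and K: "K \<ge> 0"
    and R: "R > 0" and ball: "cball y0 R \<subseteq> E" and ED: "E \<subseteq> D"
    and A: "A \<in> lmeasurable"
    and lo: "0 \<le> lo" "2 * K * lo \<le> g" and g: "0 < g" and hi: "0 \<le> hi"
    and y0: "ennreal g < v y0"
    and big: "2 * K / \<nu> * (hi / g) * measure lebesgue A \<le> R ^ CARD('n)"
  shows "\<exists>y\<in>ball y0 R. ennreal hi < v y"
proof (rule ccontr)
  assume neg: "\<not> (\<exists>y\<in>ball y0 R. ennreal hi < v y)"
  have \<nu>: "\<nu> > 0" unfolding \<nu>_def by (rule measure_unit_ball_pos)
  let ?m = "measure lebesgue A"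
  have "v y * indicator (ball y0 R) y \<le> ennreal lo * indicator (ball y0 R) y + ennreal hi * indicator A y" for y
  proof (cases "y \<in> ball y0 R")
    case True
    then have "v y \<le> ennreal hi" "y \<in> E" using neg ball by (auto simp: not_less)
    then show ?thesis using True by (cases "ennreal lo \<le> v y") (auto simp: A_def indicator_def add_increasing)
  qed simp
  then have "(\<integral>\<^sup>+ y\<in>ball y0 R. v y \<partial>lebesgue)
      \<le> (\<integral>\<^sup>+ y. ennreal lo * indicator (ball y0 R) y + ennreal hi * indicator A y \<partial>lebesgue)"
    by (intro nn_integral_mono)
  also have "\<dots> = ennreal lo * emeasure lebesgue (ball y0 R) + ennreal hi * emeasure lebesgue A"
  proof -
    have [measurable]: "A \<in> sets lebesgue" "ball y0 R \<in> sets lebesgue" using A by auto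
    show ?thesis by (subst nn_integral_add) (auto simp: nn_integral_cmult_indicator)
  qed
  also have "\<dots> = ennreal (lo * (\<nu> * R ^ CARD('n)) + hi * ?m)"
    unfolding emeasure_ball_cart[OF less_imp_le[OF R], of y0, folded \<nu>_def] emeasure_eq_measure2[OF A]
    using R lo hi \<nu> by (simp add: ennreal_plus ennreal_mult del: measure_completion)
  finally have int: "(\<integral>\<^sup>+ y\<in>ball y0 R. v y \<partial>lebesgue) \<le> ennreal (lo * (\<nu> * R ^ CARD('n)) + hi * ?m)" .
  have "ennreal g < ennreal (K / (\<nu> * R ^ CARD('n))) * (\<integral>\<^sup>+ y\<in>ball y0 R. v y \<partial>lebesgue)"
    unfolding \<nu>_def by (rule order.strict_trans2[OF y0 sub_mean_valueD[OF mv R]]) (use ball ED in auto)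
  also have "\<dots> \<le> ennreal (K / (\<nu> * R ^ CARD('n))) * ennreal (lo * (\<nu> * R ^ CARD('n)) + hi * ?m)"
    by (intro mult_left_mono int) simp
  also have "\<dots> = ennreal (K / (\<nu> * R ^ CARD('n)) * (lo * (\<nu> * R ^ CARD('n)) + hi * ?m))"
    using K R \<nu> by (intro ennreal_mult'[symmetric]) simp
  also have "K / (\<nu> * R ^ CARD('n)) * (lo * (\<nu> * R ^ CARD('n)) + hi * ?m) = K * lo + K / \<nu> * hi * ?m / R ^ CARD('n)"
    using R \<nu> by (simp add: field_simps)
  finally have "g < K * lo + K / \<nu> * hi * ?m / R ^ CARD('n)"
    using g by (simp add: ennreal_less_iff)
  moreover have "K / \<nu> * hi * ?m / R ^ CARD('n) \<le> g / 2"
  proof -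
    have "K / \<nu> * hi * ?m = g / 2 * (2 * K / \<nu> * (hi / g) * ?m)" using g \<nu> by simp
    also have "\<dots> \<le> g / 2 * R ^ CARD('n)" using big g by (intro mult_left_mono) auto
    finally show ?thesis using R pos_divide_le_eq[of "R ^ CARD('n)"] zero_less_power[OF R] by blast
  qed
  ultimately show False using lo by linarith
qed

text \<open>Chebyshev's inequality with bounded overlap. If \<open>i\<close> is the least index with
  \<open>y\<close> in \<open>A E i\<close>, any other such \<open>j\<close> satisfies
  \<open>G (j - s0) \<le> v y \<le> G (i + 1)\<close>, so \<open>j \<le> i + s0 + 1\<close> by
  strict monotonicity. Hence at most \<open>s0 + 2\<close> terms are present at \<open>y\<close>,
  each at most \<open>H y\<close>.\<close>

lemma sum_level_measure_le:
  fixes v H :: "real ^ 'n \<Rightarrow> ennreal" and G \<Phi> :: "nat \<Rightarrow> real" and m s0 :: nat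
  defines "A \<equiv> \<lambda>E j. {y\<in>E. ennreal (G (j - s0)) \<le> v y \<and> v y \<le> ennreal (G (j + 1))}"
  assumes meas: "\<And>j. A E j \<in> sets lebesgue"
    and G: "\<And>i j. m \<le> i \<Longrightarrow> i < j \<Longrightarrow> G i < G j" "\<And>j. m \<le> j \<Longrightarrow> 0 \<le> G j"
    and J: "finite J" "\<And>j. j \<in> J \<Longrightarrow> m + s0 \<le> j"
    and H: "\<And>y j. y \<in> E \<Longrightarrow> j \<in> J \<Longrightarrow> ennreal (G (j - s0)) \<le> v y \<Longrightarrow> ennreal (\<Phi> j) \<le> H y"
  shows "(\<Sum>j\<in>J. ennreal (\<Phi> j) * emeasure lebesgue (A E j)) \<le> of_nat (s0 + 2) * (\<integral>\<^sup>+ y\<in>E. H y \<partial>lebesgue)"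
proof -
  let ?c = "ennreal (1 / real (s0 + 2))"
  have c: "of_nat (s0 + 2) * ?c = 1"
    by (subst ennreal_of_nat_eq_real_of_nat, subst ennreal_mult[symmetric]) auto
  have pt: "?c * (\<Sum>j\<in>J. ennreal (\<Phi> j) * indicator (A E j) y) \<le> H y * indicator E y" for y
  proof (cases "y \<in> E")
    case True
    define S where "S = {j\<in>J. y \<in> A E j}"
    have finS: "finite S" using J unfolding S_def by auto
    have "card S \<le> s0 + 2"
    proof (cases "S = {}")
      case False
      have "S \<subseteq> {Min S..Min S + s0 + 1}"
      proof
        fix j assume j: "j \<in> S"
        let ?i = "Min S"
        have i: "?i \<in> S" using False finS by simp
        have "ennreal (G (j - s0)) \<le> v y" using j unfolding S_def A_def by blast
        also have "v y \<le> ennreal (G (?i + 1))" using i unfolding S_def A_def by blast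
        finally have "ennreal (G (j - s0)) \<le> ennreal (G (?i + 1))" .
        moreover have "?i \<in> J" using i unfolding S_def by blast
        \<comment> \<open>Nonnegativity and strict growth of \<open>G\<close> are available only
          from \<open>m\<close> on, so \<open>?i + 1\<close> has to be placed in that range.\<close>
        then have im: "m \<le> ?i + 1" using J(2)[of ?i] by linarith
        ultimately have "G (j - s0) \<le> G (?i + 1)" using G(2) by (simp add: ennreal_le_iff)
        then have "j - s0 \<le> ?i + 1" using G(1)[OF im, of "j - s0"] by (meson leI not_less)
        then show "j \<in> {?i..?i + s0 + 1}" using Min_le[OF finS j] by simp
      qed
      then have "card S \<le> card {Min S..Min S + s0 + 1}" by (intro card_mono) auto
      then show ?thesis by simp
    qed simp
    have "(\<Sum>j\<in>J. ennreal (\<Phi> j) * indicator (A E j) y) = (\<Sum>j\<in>S. ennreal (\<Phi> j))"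
      unfolding S_def sum.inter_filter[OF J(1)] by (intro sum.cong) (auto simp: indicator_def)
    also have "\<dots> \<le> (\<Sum>j\<in>S. H y)"
      by (rule sum_mono) (use H True in \<open>auto simp: S_def A_def\<close>)
    also have "\<dots> \<le> of_nat (s0 + 2) * H y"
      using \<open>card S \<le> s0 + 2\<close> by (simp only: sum_constant) (intro mult_right_mono of_nat_mono, auto)
    finally have "?c * (\<Sum>j\<in>J. ennreal (\<Phi> j) * indicator (A E j) y) \<le> ?c * (of_nat (s0 + 2) * H y)"
      by (rule mult_left_mono) simp
    also have "\<dots> = H y" by (subst mult.assoc[symmetric], subst mult.commute[of ?c]) (simp only: c mult_1_left)
    finally show ?thesis using True by simp
  qed (auto simp: A_def)
  text \<open>Linearity of the integral is applied only to the simple function on the left, because \<open>H\<close> need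
    not be measurable; hence the detour through the factor \<open>1 / (s0 + 2)\<close>.\<close>
  have "(\<Sum>j\<in>J. ennreal (\<Phi> j) * emeasure lebesgue (A E j))
      = (\<integral>\<^sup>+ y. (\<Sum>j\<in>J. ennreal (\<Phi> j) * indicator (A E j) y) \<partial>lebesgue)"
    using meas by (subst nn_integral_sum) (auto simp: nn_integral_cmult_indicator)
  also have "\<dots> = of_nat (s0 + 2) * (?c * (\<integral>\<^sup>+ y. (\<Sum>j\<in>J. ennreal (\<Phi> j) * indicator (A E j) y) \<partial>lebesgue))"
    by (subst mult.assoc[symmetric]) (simp only: c mult_1_left)
  also have "\<dots> = of_nat (s0 + 2) * (\<integral>\<^sup>+ y. ?c * (\<Sum>j\<in>J. ennreal (\<Phi> j) * indicator (A E j) y) \<partial>lebesgue)"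
    using meas by (subst nn_integral_cmult) auto
  also have "\<dots> \<le> of_nat (s0 + 2) * (\<integral>\<^sup>+ y\<in>E. H y \<partial>lebesgue)"
    by (intro mult_left_mono nn_integral_mono pt) simp
  finally show ?thesis .
qed

text \<open>Balls of the fixed radius \<open>\<rho>\<close> about points of
  \<open>ball x (2 * \<rho>)\<close> stay in \<open>cball x (3 * \<rho>)\<close>. The bound depends
  on \<open>v\<close>; it serves only to show that a walk through ever higher levels cannot go on
  forever.\<close>

lemma sub_mean_value_bounded:
  fixes v :: "real ^ 'n \<Rightarrow> ennreal" and x :: "real ^ 'n"
  assumes mv: "sub_mean_value K D v"
    and \<rho>: "\<rho> > 0" and sub: "cball x (3 * \<rho>) \<subseteq> D"
    and fin: "(\<integral>\<^sup>+ y\<in>cball x (3 * \<rho>). v y \<partial>lebesgue) < \<infinity>"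
  shows "\<exists>B. \<forall>y\<in>ball x (2 * \<rho>). v y \<le> ennreal B"
proof -
  define C where "C = ennreal (K / (measure lebesgue (ball (0 :: real ^ 'n) 1) * \<rho> ^ CARD('n))) *
     (\<integral>\<^sup>+ y\<in>cball x (3 * \<rho>). v y \<partial>lebesgue)"
  have "v y \<le> C" if y: "y \<in> ball x (2 * \<rho>)" for y
  proof -
    have sub': "cball y \<rho> \<subseteq> cball x (3 * \<rho>)"
    proof
      fix z assume "z \<in> cball y \<rho>"
      then show "z \<in> cball x (3 * \<rho>)" using y dist_triangle[of x z y] by simp
    qed
    have "v y \<le> ennreal (K / (measure lebesgue (ball (0 :: real ^ 'n) 1) * \<rho> ^ CARD('n))) *
          (\<integral>\<^sup>+ y\<in>ball y \<rho>. v y \<partial>lebesgue)"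
      by (rule sub_mean_valueD[OF mv \<rho> order.trans[OF sub' sub]])
    also have "\<dots> \<le> C"
      unfolding C_def
    proof (intro mult_left_mono nn_integral_mono)
      show "(indicator (ball y \<rho>) z :: ennreal) \<le> indicator (cball x (3 * \<rho>)) z" for z
        using subsetD[OF order.trans[OF ball_subset_cball sub'], of z] by (auto split: split_indicator)
    qed simp_all
    finally show ?thesis .
  qed
  moreover have "C < \<infinity>" using fin by (simp add: C_def ennreal_mult_less_top)
  then obtain B where "C = ennreal B" by (metis ennreal_cases less_irrefl infinity_ennreal_def)
  ultimately show ?thesis by (intro exI[of _ B]) auto
qed

lemma level_set_sets_lebesgue:
  fixes v :: "real ^ 'n \<Rightarrow> ennreal"
  assumes v: "v \<in> borel_measurable (lebesgue_on D)" and D: "D \<in> sets lebesgue"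
    and E: "E \<in> sets lebesgue" "E \<subseteq> D"
  shows "{y\<in>E. a \<le> v y \<and> v y \<le> b} \<in> sets lebesgue"
proof -
  have "{y\<in>space (lebesgue_on D). v y \<in> {a..b}} \<in> sets (lebesgue_on D)"
    using v by measurable
  then have "{y\<in>D. v y \<in> {a..b}} \<in> sets lebesgue"
    using D by (subst (asm) sets_restrict_space_iff) auto
  then have "{y\<in>D. v y \<in> {a..b}} \<inter> E \<in> sets lebesgue" using E by blast
  also have "{y\<in>D. v y \<in> {a..b}} \<inter> E = {y\<in>E. a \<le> v y \<and> v y \<le> b}" using E by auto
  finally show ?thesis .
qed

text \<open>Choosing \<open>j0\<close> before \<open>v\<close> is what gives uniformity over a
  family. In the application \<open>G j\<close> is g(j), \<open>\<Phi> j\<close> is \<phi>(j - s0),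
  \<open>H\<close> is \<psi>(F), and \<open>\<alpha> j\<close> bounds the integrand of (iii) from
  below on [j - 1, j). The condition \<open>m + s0 < j1\<close> makes \<open>G j\<close> positive
  from \<open>j1\<close> on.\<close>

lemma Domar_iteration:
  fixes D :: "(real ^ 'n) set" and x :: "real ^ 'n" and G \<Phi> \<alpha> :: "nat \<Rightarrow> real"
    and H :: "real ^ 'n \<Rightarrow> ennreal" and m s0 j1 :: nat
  assumes dim: "CARD('n) \<ge> 2" and K: "K \<ge> 0" and D: "open D"
    and \<rho>: "\<rho> > 0" and sub: "cball x (3 * \<rho>) \<subseteq> D"
    and G: "\<And>i j. m \<le> i \<Longrightarrow> i < j \<Longrightarrow> G i < G j" "\<And>j. m \<le> j \<Longrightarrow> 0 \<le> G j"
    and G_unbounded: "\<And>B. \<exists>j\<ge>m. B < G j"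
    and growth: "\<And>j. m + s0 \<le> j \<Longrightarrow> 2 * K * G (j - s0) \<le> G j"
    and j1: "m + s0 < j1"
    and \<Phi>: "\<And>j. j1 \<le> j \<Longrightarrow> 0 < \<Phi> j"
    and \<alpha>: "\<And>j. j1 \<le> j \<Longrightarrow> 0 < \<alpha> j"
      "\<And>j. j1 \<le> j \<Longrightarrow> \<alpha> j ^ (CARD('n) - 1) = G (j + 1) / (G j * \<Phi> j)"
      "summable \<alpha>"
    and H: "(\<integral>\<^sup>+ y\<in>cball x (2 * \<rho>). H y \<partial>lebesgue) < \<infinity>"
  shows "\<exists>j0. \<forall>v. v \<in> borel_measurable (lebesgue_on D) \<longrightarrow> sub_mean_value K D v \<longrightarrow>
     (\<integral>\<^sup>+ y\<in>cball x (3 * \<rho>). v y \<partial>lebesgue) < \<infinity> \<longrightarrow>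
     (\<forall>y\<in>cball x (2 * \<rho>). \<forall>j\<ge>j1. ennreal (G (j - s0)) \<le> v y \<longrightarrow> ennreal (\<Phi> j) \<le> H y) \<longrightarrow>
     (\<forall>y\<in>ball x \<rho>. v y \<le> ennreal (G j0))"
proof -
  let ?N = "CARD('n)"
  define E where "E = cball x (2 * \<rho>)"
  define \<nu> where "\<nu> = measure lebesgue (ball (0 :: real ^ 'n) 1)"
  have \<nu>: "\<nu> > 0" unfolding \<nu>_def by (rule measure_unit_ball_pos)
  define c where "c = 2 * K / \<nu>"
  have c: "c \<ge> 0" using K \<nu> by (simp add: c_def)
  have "of_nat (s0 + 2) * (\<integral>\<^sup>+ y\<in>E. H y \<partial>lebesgue) < \<infinity>"
    using H by (auto simp: E_def ennreal_mult_less_top of_nat_less_top simp del: of_nat_add)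
  then obtain C where C: "C \<ge> 0" "of_nat (s0 + 2) * (\<integral>\<^sup>+ y\<in>E. H y \<partial>lebesgue) = ennreal C"
    by (metis ennreal_cases less_irrefl infinity_ennreal_def)
  \<comment> \<open>The weight \<open>t\<close> is so large that the part of the radii coming from
    the measures of the level sets sums to less than \<open>\<rho> / 2\<close>. Dimension at least 2
    enters through \<open>t \<le> t ^ (N - 1)\<close>.\<close>
  define t where "t = 2 * c * C / \<rho> + 1"
  have t: "t \<ge> 1" using c C \<rho> by (simp add: t_def)
  have "t ^ 1 \<le> t ^ (?N - 1)" using t dim by (intro power_increasing) auto
  then have tN: "t \<le> t ^ (?N - 1)" by simp
  have "2 * c * C < \<rho> * t" using \<rho> by (simp add: t_def field_simps)
  also have "\<dots> \<le> \<rho> * t ^ (?N - 1)" using tN \<rho> by simp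
  finally have cC: "c * C / t ^ (?N - 1) < \<rho> / 2" using t by (simp add: field_simps)
  \<comment> \<open>Past \<open>n0\<close> the other part of the radii,
    \<open>t * \<alpha> j\<close>, sums to at most \<open>\<rho> / 2\<close>. Neither
    \<open>t\<close> nor \<open>n0\<close> depends on \<open>v\<close>.\<close>
  obtain n0 where n0: "\<And>m n. m \<ge> n0 \<Longrightarrow> norm (\<Sum>k=m..n. \<alpha> k) < \<rho> / (2 * t)"
    using summable_partial_sum_bound[OF \<alpha>(3), of "\<rho> / (2 * t)"] \<rho> t by auto
  define j0 where "j0 = max j1 n0"
  have j0: "j0 \<ge> j1" "j0 \<ge> n0" by (auto simp: j0_def)
  have tail: "t * (\<Sum>j=j0..<n. \<alpha> j) \<le> \<rho> / 2" for n
  proof (cases n)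
    case (Suc k)
    have "(\<Sum>j=j0..<n. \<alpha> j) \<le> \<rho> / (2 * t)" using n0[OF j0(2), of k] by (simp add: Suc atLeastLessThanSuc_atLeastAtMost)
    then have "t * (\<Sum>j=j0..<n. \<alpha> j) \<le> t * (\<rho> / (2 * t))" using t by (intro mult_left_mono) auto
    then show ?thesis using t by simp
  qed (use \<rho> in simp)
  have "\<forall>y\<in>ball x \<rho>. v y \<le> ennreal (G j0)"
    if v: "v \<in> borel_measurable (lebesgue_on D)" and mv: "sub_mean_value K D v"
      and fin: "(\<integral>\<^sup>+ y\<in>cball x (3 * \<rho>). v y \<partial>lebesgue) < \<infinity>"
      and vH: "\<forall>y\<in>cball x (2 * \<rho>). \<forall>j\<ge>j1. ennreal (G (j - s0)) \<le> v y \<longrightarrow> ennreal (\<Phi> j) \<le> H y"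
    for v
  proof (rule ccontr)
    assume "\<not> (\<forall>y\<in>ball x \<rho>. v y \<le> ennreal (G j0))"
    then obtain y0 where y0: "dist x y0 < \<rho>" "ennreal (G j0) < v y0" by (auto simp: not_le)
    define A where "A j = {y\<in>E. ennreal (G (j - s0)) \<le> v y \<and> v y \<le> ennreal (G (j + 1))}" for j
    have ED: "E \<subseteq> D" using sub \<rho> by (auto simp: E_def)
    have A_sets: "A j \<in> sets lebesgue" for j
      unfolding A_def by (rule level_set_sets_lebesgue[OF v]) (use D ED in \<open>auto simp: E_def\<close>)
    have A: "A j \<in> lmeasurable" for j
      by (rule fmeasurableI2[OF _ _ A_sets, of E]) (auto simp: A_def E_def)
    define \<mu> where "\<mu> j = measure lebesgue (A j)" for j
    have \<mu>: "\<mu> j \<ge> 0" for j by (simp add: \<mu>_def)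
    have \<Phi>0: "0 \<le> \<Phi> j" if "j \<ge> j0" for j using less_imp_le[OF \<Phi>[of j]] j0 that by simp
    have sum_\<mu>: "(\<Sum>j=j0..<n. \<Phi> j * \<mu> j) \<le> C" for n
    proof -
      have "ennreal (\<Sum>j=j0..<n. \<Phi> j * \<mu> j) = (\<Sum>j=j0..<n. ennreal (\<Phi> j * \<mu> j))"
        using \<Phi>0 \<mu> by (intro sum_ennreal[symmetric] mult_nonneg_nonneg) auto
      also have "\<dots> = (\<Sum>j=j0..<n. ennreal (\<Phi> j) * emeasure lebesgue (A j))"
        unfolding \<mu>_def emeasure_eq_measure2[OF A]
        using \<Phi>0 by (intro sum.cong refl ennreal_mult) auto
      also have "\<dots> \<le> of_nat (s0 + 2) * (\<integral>\<^sup>+ y\<in>E. H y \<partial>lebesgue)"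
        unfolding A_def
        by (rule sum_level_measure_le[where m = m]) (use A_sets G j0 j1 vH in \<open>auto simp: A_def E_def\<close>)
      finally show ?thesis using C by (simp add: ennreal_le_iff)
    qed
    text \<open>The two summands \<open>a\<close>, \<open>b\<close> of \<open>R j\<close> satisfy \<open>a\<^sup>N\<^sup>-\<^sup>1 b = c (G (j + 1) / G j) \<mu> j\<close>, so that
      \<open>(a + b)\<^sup>N \<ge> a\<^sup>N\<^sup>-\<^sup>1 b\<close> takes the place of Hoelder's inequality in bounding the sum of the radii.\<close>
    define R where "R j = t * \<alpha> j + c * \<Phi> j * \<mu> j / t ^ (?N - 1)" for j
    have R0: "0 < R j" if "j \<ge> j0" for j
      unfolding R_def using \<alpha>(1)[of j] \<Phi>[of j] \<mu>[of j] c t j0 that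
      by (intro add_pos_nonneg) (auto intro!: divide_nonneg_nonneg mult_nonneg_nonneg)
    have sum_R: "(\<Sum>j=j0..<n. R j) < \<rho>" for n
    proof -
      have "(\<Sum>j=j0..<n. R j) = t * (\<Sum>j=j0..<n. \<alpha> j) + c / t ^ (?N - 1) * (\<Sum>j=j0..<n. \<Phi> j * \<mu> j)"
        unfolding R_def sum.distrib sum_distrib_left by (simp add: mult_ac)
      also have "\<dots> \<le> \<rho> / 2 + c / t ^ (?N - 1) * C"
        using tail sum_\<mu> c t by (intro add_mono mult_left_mono) auto
      also have "\<dots> = \<rho> / 2 + c * C / t ^ (?N - 1)" by simp
      also have "\<dots> < \<rho>" using cC by linarith
      finally show ?thesis .
    qed
    have R_big: "2 * K / \<nu> * (G (j + 1) / G j) * \<mu> j \<le> R j ^ ?N" if j: "j \<ge> j0" for j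
    proof -
      let ?y = "c * \<Phi> j * \<mu> j / t ^ (?N - 1)"
      have y: "0 \<le> ?y" using \<Phi>[of j] \<mu>[of j] c t j0 j by (auto intro!: divide_nonneg_nonneg mult_nonneg_nonneg)
      have a: "0 < \<alpha> j" using \<alpha>(1)[of j] j0 j by simp
      have "2 * K / \<nu> * (G (j + 1) / G j) * \<mu> j = c * (\<alpha> j ^ (?N - 1) * \<Phi> j) * \<mu> j"
        using \<alpha>(2)[of j] \<Phi>[of j] j0 j by (simp add: c_def)
      also have "\<dots> = (t * \<alpha> j) ^ (?N - 1) * ?y"
        using t by (simp add: power_mult_distrib)
      also have "\<dots> \<le> R j ^ (?N - 1) * R j"
        using a t y unfolding R_def by (intro mult_mono power_mono) auto
      also have "\<dots> = R j ^ ?N"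
        using dim by (simp flip: power_Suc2)
      finally show ?thesis .
    qed
    \<comment> \<open>Since all radii together stay below \<open>\<rho>\<close>, every ball used
      starts within \<open>2 * \<rho>\<close> of \<open>x\<close> and remains in \<open>E\<close>,
      so the next step is always possible.\<close>
    have walk: "\<exists>y. dist x y < \<rho> + (\<Sum>j=j0..<n. R j) \<and> ennreal (G n) < v y" if "n \<ge> j0" for n
      using that
    proof (induction n rule: dec_induct)
      case base
      then show ?case using y0 by auto
    next
      case (step n)
      then obtain y where y: "dist x y < \<rho> + (\<Sum>j=j0..<n. R j)" "ennreal (G n) < v y" by blast
      have Suc: "(\<Sum>j=j0..<Suc n. R j) = (\<Sum>j=j0..<n. R j) + R n" using step by simp
      have "cball y (R n) \<subseteq> E"
      proof
        fix z assume "z \<in> cball y (R n)"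
        then have "dist x z < \<rho> + (\<Sum>j=j0..<Suc n. R j)"
          using dist_triangle[of x z y] y Suc by simp
        then show "z \<in> E" using sum_R[of "Suc n"] by (simp add: E_def)
      qed
      \<comment> \<open>This gives \<open>growth\<close> at \<open>n\<close>,
        \<open>0 \<le> G (n - s0)\<close>, and \<open>0 < G n\<close> from
        \<open>0 \<le> G m < G n\<close>.\<close>
      have "m + s0 < n" using step j0 j1 by simp
      then have "\<exists>z\<in>ball y (R n). ennreal (G (n + 1)) < v z"
        using \<open>cball y (R n) \<subseteq> E\<close> K step y
        by (intro sub_mean_value_step[OF mv K R0 _ ED, where lo = "G (n - s0)" and g = "G n"])
          (use A[of n] R_big[of n] G(2)[of "n - s0"] G(2)[of "n + 1"] G(1)[of m n] G(2)[of m] growth[of n]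
            in \<open>auto simp: A_def \<mu>_def \<nu>_def\<close>)
      then obtain z where z: "dist y z < R n" "ennreal (G (Suc n)) < v z" by auto
      have "dist x z < \<rho> + (\<Sum>j=j0..<Suc n. R j)"
        using dist_triangle[of x z y] y z Suc by simp
      then show ?case using z by blast
    qed
    obtain B where B: "\<And>y. y \<in> ball x (2 * \<rho>) \<Longrightarrow> v y \<le> ennreal B"
      using sub_mean_value_bounded[OF mv \<rho> sub fin] by blast
    obtain k where k: "k \<ge> m" "B < G k" using G_unbounded by blast
    \<comment> \<open>The \<open>+ 1\<close> puts \<open>n\<close> strictly above \<open>k\<close>,
      so that \<open>B < G k < G n\<close>.\<close>
    define n where "n = max j0 k + 1"
    have "n \<ge> j0" "k < n" by (auto simp: n_def less_Suc_eq_le)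
    then have n: "n \<ge> j0" "B < G n" using G(1)[OF k(1), of n] k by auto
    obtain y where y: "dist x y < \<rho> + (\<Sum>j=j0..<n. R j)" "ennreal (G n) < v y" using walk[OF n(1)] by blast
    then have "v y \<le> ennreal B" using sum_R[of n] by (intro B) auto
    also have "\<dots> \<le> ennreal (G n)" using n by (intro ennreal_leI) auto
    finally show False using y by simp
  qed
  then show ?thesis by blast
qed

section \<open>Functions with an inverse above a level\<close>

lemma ennreal_powr_mono:
  assumes "x \<le> y" "0 \<le> p"
  shows "ennreal_powr x p \<le> ennreal_powr y p"
proof (cases "y = \<infinity>")
  case False
  then have "x \<noteq> \<infinity>" "enn2real x \<le> enn2real y"
    using assms by (auto simp: top_unique less_top intro!: enn2real_mono)
  then show ?thesis using False assms by (auto simp: ennreal_powr_def intro!: ennreal_leI powr_mono2)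
qed (simp add: ennreal_powr_def)

lemma ennreal_divide_mono:
  fixes a b c d :: ennreal
  assumes "a \<le> c" "d \<le> b"
  shows "a / b \<le> c / d"
proof -
  have "inverse b \<le> inverse d"
    using assms(2)
    by (simp add: less_eq_ennreal.rep_eq inverse_ennreal.rep_eq ereal_inverse_antimono enn2ereal_nonneg)
  then show ?thesis unfolding divide_ennreal_def using assms(1) by (intro mult_mono) auto
qed

lemma inverse_defined_on_inv:
  assumes "inverse_defined_on h {c..}" "c \<le> t"
  shows "h (inv h t) = t"
proof -
  have "t \<in> range h" using assms unfolding inverse_defined_on_def by (metis atLeast_iff rangeI)
  then show ?thesis by (rule f_inv_into_f)
qed

text \<open>Monotonicity gives the weak inequality; equality would give two preimages to a value in
  the range where preimages are unique.\<close>

lemma inverse_defined_on_strict_mono: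
  assumes "inverse_defined_on h {c..}" "mono h" "c \<le> h s" "s < s'"
  shows "h s < h s'"
proof -
  have "h s \<le> h s'" using assms by (simp add: monoD)
  moreover have "h s \<noteq> h s'" using assms unfolding inverse_defined_on_def by (metis atLeast_iff less_irrefl)
  ultimately show ?thesis by simp
qed

lemma inverse_defined_on_inv_strict_mono:
  assumes "inverse_defined_on h {c..}" "mono h" "c \<le> t" "t < t'"
  shows "inv h t < inv h t'"
proof (rule ccontr)
  assume "\<not> inv h t < inv h t'"
  then have "h (inv h t') \<le> h (inv h t)" using assms(2) by (simp add: monoD)
  then show False using inverse_defined_on_inv[OF assms(1)] assms(3,4) by auto
qed

text \<open>The intervals [j - 1, j) with j > k are disjoint and lie in \<open>{real k..}\<close>,
  so every partial sum is the integral of a step function below \<open>f\<close>. Only the step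
  function is integrated term by term, because \<open>f\<close> need not be measurable.\<close>

lemma summable_if_integral_dominates:
  fixes f :: "real \<Rightarrow> ennreal" and \<alpha> :: "nat \<Rightarrow> real"
  assumes \<alpha>: "\<And>j. k < j \<Longrightarrow> 0 \<le> \<alpha> j"
    and f: "\<And>j s. k < j \<Longrightarrow> real j - 1 \<le> s \<Longrightarrow> s < real j \<Longrightarrow> ennreal (\<alpha> j) \<le> f s"
    and fin: "(\<integral>\<^sup>+ s\<in>{real k..}. f s \<partial>lebesgue) < \<infinity>"
  shows "summable \<alpha>"
proof -
  obtain I where I: "0 \<le> I" "(\<integral>\<^sup>+ s\<in>{real k..}. f s \<partial>lebesgue) = ennreal I"
    using fin by (metis ennreal_cases less_irrefl infinity_ennreal_def)
  \<comment> \<open>With the index shifted by \<open>k + 1\<close>, \<open>?B j\<close> is the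
    interval [i - 1, i) for i = j + k + 1.\<close>
  let ?B = "\<lambda>j. {real j + real k..<real j + real k + 1}"
  have "(\<Sum>j<n. \<alpha> (j + (k + 1))) \<le> I" for n
  proof -
    have pt: "(\<Sum>j<n. ennreal (\<alpha> (j + (k + 1))) * indicator (?B j) s) \<le> f s * indicator {real k..} s" for s
    proof (cases "real k \<le> s")
      case True
      define i where "i = nat \<lfloor>s - real k\<rfloor>"
      have i: "real i \<le> s - real k" "s - real k < real i + 1"
        using True by (auto simp: i_def)
      have "s \<in> ?B j \<longleftrightarrow> j = i" for j using i by auto
      then have "(\<Sum>j<n. ennreal (\<alpha> (j + (k + 1))) * indicator (?B j) s)
          = (\<Sum>j<n. if j = i then ennreal (\<alpha> (i + (k + 1))) else 0)"
        by (intro sum.cong) (auto simp: indicator_def)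
      also have "\<dots> \<le> ennreal (\<alpha> (i + (k + 1)))" by simp
      also have "\<dots> \<le> f s" using i by (intro f) auto
      finally show ?thesis using True by simp
    qed (auto simp: indicator_def)
    have "ennreal (\<Sum>j<n. \<alpha> (j + (k + 1))) = (\<Sum>j<n. ennreal (\<alpha> (j + (k + 1))) * emeasure lebesgue (?B j))"
      using \<alpha> by (subst sum_ennreal[symmetric]) auto
    also have "\<dots> = (\<integral>\<^sup>+ s. (\<Sum>j<n. ennreal (\<alpha> (j + (k + 1))) * indicator (?B j) s) \<partial>lebesgue)"
    proof -
      have [measurable]: "?B j \<in> sets lebesgue" for j by simp
      show ?thesis by (subst nn_integral_sum) (auto simp: nn_integral_cmult_indicator)
    qed
    also have "\<dots> \<le> ennreal I" unfolding I(2)[symmetric] by (intro nn_integral_mono pt)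
    finally show ?thesis using I by simp
  qed
  then have "summable (\<lambda>j. \<alpha> (j + (k + 1)))"
    using \<alpha> by (intro summableI_nonneg_bounded) auto
  then show ?thesis by (simp only: summable_iff_shift)
qed

section \<open>Upper semicontinuous regularization\<close>

lemma usc_regularization_le:
  assumes "open S" "x \<in> S" "\<And>y. y \<in> S \<Longrightarrow> y \<in> D \<Longrightarrow> w y \<le> b"
  shows "usc_regularization D w x \<le> b"
  unfolding usc_regularization_def
  by (rule Limsup_bounded) (use assms in \<open>auto simp: eventually_inf_principal eventually_nhds\<close>)

text \<open>The filter \<open>nhds x\<close> does not exclude \<open>x\<close>, so every eventual
  property holds at \<open>x\<close> itself.\<close>

lemma le_usc_regularization:
  assumes "x \<in> D"
  shows "w x \<le> usc_regularization D w x"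
  unfolding usc_regularization_def Limsup_def
proof (rule INF_greatest)
  fix P assume "P \<in> {P. eventually P (inf (nhds x) (principal D))}"
  then have "P x" using assms by (auto simp: eventually_inf_principal dest: eventually_nhds_x_imp_x)
  then show "w x \<le> Sup (w ` {x. P x})" by (intro SUP_upper) simp
qed

text \<open>Upper semicontinuity: a neighbourhood witnessing that the upper limit at
  \<open>x\<close> is below \<open>a\<close> is a witness for all its points. Measurability and
  boundedness on compact sets follow from it.\<close>

lemma open_usc_regularization_less:
  assumes "open D"
  shows "open {x\<in>D. usc_regularization D w x < a}"
proof (subst open_subopen, intro ballI)
  fix x assume "x \<in> {x\<in>D. usc_regularization D w x < a}"
  then have x: "x \<in> D" "usc_regularization D w x < a" by auto
  then obtain P where P: "eventually P (inf (nhds x) (principal D))" "Sup (w ` {x. P x}) < a"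
    unfolding usc_regularization_def Limsup_def by (auto simp: INF_less_iff)
  then obtain S where S: "open S" "x \<in> S" "\<And>y. y \<in> S \<Longrightarrow> y \<in> D \<Longrightarrow> P y"
    by (auto simp: eventually_inf_principal eventually_nhds)
  have "usc_regularization D w y < a" if "y \<in> S" for y
  proof -
    have "usc_regularization D w y \<le> Sup (w ` {x. P x})"
      using S(3) by (intro usc_regularization_le[OF S(1) that] SUP_upper) auto
    then show ?thesis using P(2) by simp
  qed
  then show "\<exists>T. open T \<and> x \<in> T \<and> T \<subseteq> {x\<in>D. usc_regularization D w x < a}"
    using S x assms by (intro exI[of _ "S \<inter> D"]) auto
qed

lemma usc_regularization_borel_measurable:
  assumes "open D"
  shows "usc_regularization D w \<in> borel_measurable (lebesgue_on D)"
proof (rule borel_measurableI_less)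
  fix a
  have "{x\<in>D. usc_regularization D w x < a} \<in> sets (lebesgue_on D)"
    using open_usc_regularization_less[OF assms, of w a] assms
    by (subst sets_restrict_space_iff) auto
  then show "{x \<in> space (lebesgue_on D). usc_regularization D w x < a} \<in> sets (lebesgue_on D)"
    by simp
qed

lemma usc_regularization_bounded_on_compact:
  assumes D: "open D" and E: "compact E" "E \<subseteq> D"
    and fin: "\<And>x. x \<in> D \<Longrightarrow> usc_regularization D w x < \<infinity>"
  shows "\<exists>n::nat. \<forall>x\<in>E. usc_regularization D w x \<le> of_nat n"
proof -
  let ?U = "\<lambda>n::nat. {x\<in>D. usc_regularization D w x < of_nat n}"
  have "E \<subseteq> (\<Union>n\<in>UNIV. ?U n)"
    using E fin ennreal_Ex_less_of_nat by fastforce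
  then obtain N where N: "finite N" "E \<subseteq> (\<Union>n\<in>N. ?U n)"
    using compactE_image[OF E(1), of UNIV ?U] open_usc_regularization_less[OF D] by auto
  show ?thesis
  proof (intro exI ballI)
    fix x assume "x \<in> E"
    then obtain n where n: "n \<in> N" "usc_regularization D w x < of_nat n" using N by blast
    then have "n \<le> Max N" using N by simp
    then have "(of_nat n :: ennreal) \<le> of_nat (Max N)" by (rule of_nat_mono)
    with n(2) show "usc_regularization D w x \<le> of_nat (Max N)" by (meson order_less_imp_le order_trans)
  qed
qed

text \<open>The mean value inequality at \<open>y\<close> near \<open>x\<close>, with integrand
  enlarged to the regularization, passes to the supremum over \<open>V\<close> and then to the upper
  limit in \<open>y\<close>. The radius lost on the way is recovered by letting \<open>r'\<close>
  tend to \<open>r\<close>.\<close>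

lemma sub_mean_value_usc_regularization:
  fixes D :: "(real ^ 'n) set" and V :: "(real ^ 'n \<Rightarrow> ennreal) set"
  assumes K: "K > 0" and V: "\<And>v. v \<in> V \<Longrightarrow> sub_mean_value K D v"
    and w: "\<And>x. x \<in> D \<Longrightarrow> w x = (SUP v\<in>V. v x)"
  shows "sub_mean_value K D (usc_regularization D w)"
  unfolding sub_mean_value_def
proof (intro allI impI)
  fix x :: "real ^ 'n" and r :: real
  assume "r > 0 \<and> cball x r \<subseteq> D"
  then have r: "r > 0" "cball x r \<subseteq> D" by auto
  define \<nu> where "\<nu> = measure lebesgue (ball (0 :: real ^ 'n) 1)"
  have \<nu>: "\<nu> > 0" unfolding \<nu>_def by (rule measure_unit_ball_pos)
  define W where "W = usc_regularization D w"
  define I where "I = (\<integral>\<^sup>+ y\<in>ball x r. W y \<partial>lebesgue)"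
  text \<open>With a radius \<open>r' < r\<close>, the balls around all points near \<open>x\<close> stay in \<open>ball x r\<close>.\<close>
  have le: "W x \<le> ennreal (K / (\<nu> * r' ^ CARD('n))) * I" if r': "0 < r'" "r' < r" for r'
    unfolding W_def
  proof (rule usc_regularization_le[of "ball x (r - r')"])
    fix y assume y: "y \<in> ball x (r - r')" "y \<in> D"
    have sub: "cball y r' \<subseteq> ball x r"
    proof
      fix z assume "z \<in> cball y r'"
      then show "z \<in> ball x r" using y dist_triangle[of x z y] by simp
    qed
    have "v y \<le> ennreal (K / (\<nu> * r' ^ CARD('n))) * I" if v: "v \<in> V" for v
    proof -
      have vW: "v z \<le> W z" if "z \<in> D" for z
      proof -
        have "v z \<le> w z" unfolding w[OF that] using v by (rule SUP_upper)
        then show ?thesis unfolding W_def using le_usc_regularization[OF that] by (rule order.trans)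
      qed
      have "v y \<le> ennreal (K / (\<nu> * r' ^ CARD('n))) * (\<integral>\<^sup>+ z\<in>ball y r'. v z \<partial>lebesgue)"
        unfolding \<nu>_def using sub r ball_subset_cball[of x r] by (intro sub_mean_valueD[OF V[OF v] r'(1)]) blast
      also have "\<dots> \<le> ennreal (K / (\<nu> * r' ^ CARD('n))) * I"
        unfolding I_def
      proof (intro mult_left_mono nn_integral_mono)
        fix z
        show "v z * indicator (ball y r') z \<le> W z * indicator (ball x r) z"
        proof (cases "z \<in> ball y r'")
          case True
          then have "z \<in> ball x r" using sub ball_subset_cball by blast
          moreover from this have "z \<in> D" using r ball_subset_cball by blast
          ultimately show ?thesis using True vW by simp
        qed simp
      qed simp
      finally show ?thesis .
    qed
    then show "w y \<le> ennreal (K / (\<nu> * r' ^ CARD('n))) * I"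
      using y w by (auto intro: SUP_least)
  qed (use r' in auto)
  show "usc_regularization D w x \<le> ennreal (K / (measure lebesgue (ball (0 :: real ^ 'n) 1) * r ^ CARD('n))) *
      (\<integral>\<^sup>+ y\<in>ball x r. usc_regularization D w y \<partial>lebesgue)"
    unfolding \<nu>_def[symmetric] W_def[symmetric] I_def[symmetric]
  proof (cases "I = \<infinity>")
    \<comment> \<open>Here \<open>K > 0\<close> matters: the factor is positive, so the right-hand
      side is \<infinity>.\<close>
    case True
    then show "W x \<le> ennreal (K / (\<nu> * r ^ CARD('n))) * I"
      using K \<nu> r by (simp add: ennreal_mult_top)
  next
    case False
    then obtain i where i: "i \<ge> 0" "I = ennreal i" by (metis ennreal_cases infinity_ennreal_def)
    have "((\<lambda>r'. ennreal (K / (\<nu> * r' ^ CARD('n)) * i)) \<longlongrightarrow> ennreal (K / (\<nu> * r ^ CARD('n)) * i)) (at_left r)"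
      using \<nu> r by (intro tendsto_intros) auto
    moreover have "\<forall>\<^sub>F r' in at_left r. W x \<le> ennreal (K / (\<nu> * r' ^ CARD('n)) * i)"
      using eventually_at_left_real[OF r(1)]
    proof (rule eventually_mono)
      fix r' assume "r' \<in> {0<..<r}"
      then show "W x \<le> ennreal (K / (\<nu> * r' ^ CARD('n)) * i)"
        unfolding ennreal_mult''[OF i(1)] i(2)[symmetric] by (intro le) auto
    qed
    ultimately have "W x \<le> ennreal (K / (\<nu> * r ^ CARD('n)) * i)"
      by (rule tendsto_lowerbound) simp
    then show "W x \<le> ennreal (K / (\<nu> * r ^ CARD('n))) * I"
      unfolding ennreal_mult''[OF i(1)] i(2)[symmetric] .
  qed
qed

section \<open>Quasinear subharmonicity and the mean value inequality for nonnegative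
  functions\<close>

lemma quasinearly_subharmonic_imp_sub_mean_value:
  assumes "quasinearly_subharmonic K D u"
  shows "sub_mean_value K D (pos_part u)"
proof -
  have "lower_trunc u 0 = pos_part u"
    by (rule ext) (simp add: lower_trunc_def pos_part_def flip: zero_ereal_def)
  then show ?thesis
    using assms[unfolded quasinearly_subharmonic_def, THEN conjunct2, THEN conjunct2, THEN conjunct2, rule_format, where M = 0]
    by (simp only: sub_mean_value_def) simp
qed

lemma pos_part_borel_measurable:
  assumes "u \<in> borel_measurable M"
  shows "pos_part u \<in> borel_measurable M"
  using assms unfolding pos_part_def[abs_def] by measurable

lemma lower_trunc_enn2ereal:
  assumes "M \<ge> 0"
  shows "lower_trunc (\<lambda>x. enn2ereal (W x)) M x = W x + ennreal M"
proof (cases "W x")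
  case (real r)
  then show ?thesis using assms by (simp add: lower_trunc_def enn2ereal_ennreal max_def flip: ennreal_plus)
next
  case top
  then show ?thesis by (simp add: lower_trunc_def)
qed

text \<open>For nonnegative \<open>W\<close> the truncation is \<open>W + M\<close>, so the case M =
  0 has to survive adding a constant. It does because \<open>K \<ge> 1\<close>:
  \<open>M \<le> K * M\<close>, and \<open>K * M\<close> is the mean value expression of the
  constant \<open>M\<close>.\<close>

lemma quasinearly_subharmonic_enn2ereal:
  fixes D :: "(real ^ 'n) set"
  assumes D: "open D" and K: "K \<ge> 1" and fin: "\<And>x. x \<in> D \<Longrightarrow> W x < \<infinity>"
    and W: "W \<in> borel_measurable (lebesgue_on D)"
    and int: "\<And>E. compact E \<Longrightarrow> E \<subseteq> D \<Longrightarrow> (\<integral>\<^sup>+ x\<in>E. W x \<partial>lebesgue) < \<infinity>"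
    and mv: "sub_mean_value K D W"
  shows "quasinearly_subharmonic K D (\<lambda>x. enn2ereal (W x))"
  unfolding quasinearly_subharmonic_def
proof (intro conjI ballI allI impI)
  show "enn2ereal (W x) < \<infinity>" if "x \<in> D" for x
    using fin[OF that] by (cases "W x") auto
  show "(\<lambda>x. enn2ereal (W x)) \<in> borel_measurable (lebesgue_on D)" using W by measurable
  have "pos_part (\<lambda>x. enn2ereal (W x)) = W"
    by (auto simp: pos_part_def max_absorb1 enn2ereal_nonneg)
  then show "locally_integrable_on (pos_part (\<lambda>x. enn2ereal (W x))) D"
    using W int unfolding locally_integrable_on_def by auto
next
  fix x :: "real ^ 'n" and r M :: real
  assume "r > 0 \<and> cball x r \<subseteq> D \<and> M \<ge> 0"
  then have r: "r > 0" "cball x r \<subseteq> D" and M: "M \<ge> 0" by auto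
  let ?\<nu> = "measure lebesgue (ball (0 :: real ^ 'n) 1)"
  have \<nu>: "?\<nu> > 0" by (rule measure_unit_ball_pos)
  let ?k = "K / (?\<nu> * r ^ CARD('n))"
  have k: "?k \<ge> 0" using K r \<nu> by (intro divide_nonneg_nonneg mult_nonneg_nonneg) auto
  \<comment> \<open>Measurability is known on \<open>D\<close> only. Cutting off by the ball, which
    lies in \<open>D\<close>, carries it to the whole space, as additivity of the integral
    requires.\<close>
  have "(\<lambda>y. W y * indicator D y) \<in> borel_measurable lebesgue"
    using W D by (subst (asm) borel_measurable_restrict_space_iff_ennreal) auto
  moreover have [measurable]: "ball x r \<in> sets lebesgue" by simp
  ultimately have "(\<lambda>y. W y * indicator D y * indicator (ball x r) y) \<in> borel_measurable lebesgue"
    by measurable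
  also have "(\<lambda>y. W y * indicator D y * indicator (ball x r) y) = (\<lambda>y. W y * indicator (ball x r) y)"
    using r by (auto simp: indicator_def fun_eq_iff subset_iff)
  finally have meas[measurable]: "(\<lambda>y. W y * indicator (ball x r) y) \<in> borel_measurable lebesgue" .
  have "W x + ennreal M \<le> ennreal ?k * (\<integral>\<^sup>+ y\<in>ball x r. W y \<partial>lebesgue) + ennreal (K * M)"
    using K M by (intro add_mono sub_mean_valueD[OF mv r] ennreal_leI) (simp add: mult_left_le mult_le_cancel_right1)
  also have "ennreal (K * M) = ennreal ?k * (ennreal M * emeasure lebesgue (ball x r))"
    unfolding emeasure_ball_cart[OF less_imp_le[OF r(1)]]
  proof -
    have "K * M = ?k * (M * (?\<nu> * r ^ CARD('n)))" using \<nu> r by (simp del: measure_completion)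
    then have "ennreal (K * M) = ennreal (?k * (M * (?\<nu> * r ^ CARD('n))))" by (rule arg_cong)
    also have "\<dots> = ennreal ?k * (ennreal M * ennreal (?\<nu> * r ^ CARD('n)))"
      using k M by (simp only: ennreal_mult')
    finally show "ennreal (K * M) = ennreal ?k * (ennreal M * ennreal (?\<nu> * r ^ CARD('n)))" .
  qed
  also have "ennreal ?k * (\<integral>\<^sup>+ y\<in>ball x r. W y \<partial>lebesgue) + ennreal ?k * (ennreal M * emeasure lebesgue (ball x r))
      = ennreal ?k * ((\<integral>\<^sup>+ y\<in>ball x r. W y \<partial>lebesgue) + ennreal M * emeasure lebesgue (ball x r))"
    by (rule distrib_left[symmetric])
  also have "(\<integral>\<^sup>+ y\<in>ball x r. W y \<partial>lebesgue) + ennreal M * emeasure lebesgue (ball x r)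
      = (\<integral>\<^sup>+ y. W y * indicator (ball x r) y + ennreal M * indicator (ball x r) y \<partial>lebesgue)"
    by (subst nn_integral_add[OF meas]) (simp_all add: nn_integral_cmult_indicator)
  also have "\<dots> = (\<integral>\<^sup>+ y\<in>ball x r. lower_trunc (\<lambda>x. enn2ereal (W x)) M y \<partial>lebesgue)"
    by (simp only: lower_trunc_enn2ereal[OF M] distrib_right)
  finally show "lower_trunc (\<lambda>x. enn2ereal (W x)) M x \<le> ennreal ?k *
      (\<integral>\<^sup>+ y\<in>ball x r. lower_trunc (\<lambda>x. enn2ereal (W x)) M y \<partial>lebesgue)"
    by (simp only: lower_trunc_enn2ereal[OF M])
qed

section \<open>Domination and local boundedness\<close>

lemma pos_part_le:
  assumes "u x \<le> enn2ereal b"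
  shows "pos_part u x \<le> b"
proof -
  have "max (u x) 0 \<le> enn2ereal b" using assms by (simp add: enn2ereal_nonneg)
  then have "e2ennreal (max (u x) 0) \<le> e2ennreal (enn2ereal b)" by (rule e2ennreal_mono)
  then show ?thesis by (simp add: pos_part_def)
qed

text \<open>The condition \<open>0 \<le> C\<close> is essential: for negative \<open>C\<close>,
  \<open>ennreal C\<close> is 0.\<close>

lemma le_pos_partD:
  assumes "pos_part u x \<le> ennreal C" "0 \<le> C"
  shows "u x \<le> ereal C"
proof -
  have "u x \<le> max (u x) 0" by simp
  also have "\<dots> = enn2ereal (pos_part u x)" by (simp add: pos_part_def enn2ereal_e2ennreal)
  also have "\<dots> \<le> enn2ereal (ennreal C)" using assms(1) by (simp add: less_eq_ennreal.rep_eq)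
  also have "\<dots> = ereal C" using assms(2) by (simp add: enn2ereal_ennreal)
  finally show ?thesis .
qed

theorem theorem3p3:
  fixes D :: "(real ^ 'n) set"
    and K :: real
    and \<phi> \<psi> :: "ennreal \<Rightarrow> ennreal"
    and s0 s1 :: nat
    and \<F> :: "(real ^ 'n \<Rightarrow> ereal) set"
    and F :: "real ^ 'n \<Rightarrow> ennreal"
    and w :: "real ^ 'n \<Rightarrow> ennreal"
  assumes dim: "CARD('n) \<ge> 2"
    and dom: "domain_in D"
    and K: "K \<ge> 1"
    and mono_phi: "mono \<phi>"
    and mono_psi: "mono \<psi>"
    and s0_s1: "s0 < s1"
    and inv_phi: "inverse_defined_on \<phi> {min (\<phi> (of_nat (s1 - s0))) (\<psi> (of_nat (s1 - s0)))..}"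
    and inv_psi: "inverse_defined_on \<psi> {min (\<phi> (of_nat (s1 - s0))) (\<psi> (of_nat (s1 - s0)))..}"
    and growth: "\<And>s. s \<ge> of_nat s1 \<Longrightarrow>
        ennreal (2 * K) * (inv \<psi> \<circ> \<phi>) (s - of_nat s0) \<le> (inv \<psi> \<circ> \<phi>) s"
    and int_conv: "(\<integral>\<^sup>+ s\<in>{real s1..}.
        ennreal_powr
          ((inv \<psi> \<circ> \<phi>) (ennreal (s + 2)) / (inv \<psi> \<circ> \<phi>) (ennreal s)
            * (1 / \<phi> (ennreal (s - real s0))))
          (1 / (real CARD('n) - 1)) \<partial>lebesgue) < \<infinity>"
    and qns: "\<And>u. u \<in> \<F> \<Longrightarrow> quasinearly_subharmonic K D u"
    and F_meas: "F \<in> borel_measurable (lebesgue_on D)"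
    and dominated: "\<And>u x. u \<in> \<F> \<Longrightarrow> x \<in> D \<Longrightarrow> u x \<le> enn2ereal (F x)"
    and F_int: "\<And>E. compact E \<Longrightarrow> E \<subseteq> D \<Longrightarrow> (\<integral>\<^sup>+ x\<in>E. \<psi> (F x) \<partial>lebesgue) < \<infinity>"
    and w_eq: "\<And>x. w x = (SUP u\<in>\<F>. pos_part u x)"
  shows "locally_uniformly_bounded D \<F> \<and>
    (\<forall>x\<in>D. usc_regularization D w x < \<infinity>) \<and>
    quasinearly_subharmonic K D (\<lambda>x. enn2ereal (usc_regularization D w x))"
proof -

  \<comment> \<open>Monotonicity, finiteness and positivity of \<phi> and g from m on\<close>
  define m where "m = s1 - s0"
  define c where "c = min (\<phi> (of_nat m)) (\<psi> (of_nat m))"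
  define g where "g = inv \<psi> \<circ> \<phi>"
  define p where "p = 1 / (real CARD('n) - 1)"
  have m: "m > 0" "m + s0 = s1" using s0_s1 by (auto simp: m_def)
  have inv\<phi>: "inverse_defined_on \<phi> {c..}" and inv\<psi>: "inverse_defined_on \<psi> {c..}"
    using inv_phi inv_psi unfolding c_def m_def by auto
  have D: "open D" using dom by (simp add: domain_in_def)
  have c_le: "c \<le> \<phi> s" if "of_nat m \<le> s" for s
    using monoD[OF mono_phi that] by (simp add: c_def min_le_iff_disj)
  have \<phi>_strict: "\<phi> s < \<phi> s'" if "of_nat m \<le> s" "s < s'" for s s'
    using inverse_defined_on_strict_mono[OF inv\<phi> mono_phi c_le] that by blast
  have g_strict: "g s < g s'" if "of_nat m \<le> s" "s < s'" for s s'
    using inverse_defined_on_inv_strict_mono[OF inv\<psi> mono_psi c_le \<phi>_strict] that by (simp add: g_def)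
  have \<phi>_mono: "\<phi> s \<le> \<phi> s'" if "s \<le> s'" for s s' using mono_phi that by (rule monoD)
  have g_mono: "g s \<le> g s'" if "of_nat m \<le> s" "s \<le> s'" for s s'
    using g_strict[of s s'] that by (auto simp: le_less)
  have \<psi>_g: "\<psi> (g s) = \<phi> s" if "of_nat m \<le> s" for s
    using inverse_defined_on_inv[OF inv\<psi> c_le[OF that]] by (simp add: g_def)
  \<comment> \<open>Strict growth extends up to the argument \<infinity>, so values at finite
    arguments lie strictly below the value there.\<close>
  have fin: "\<phi> s < \<infinity>" "g s < \<infinity>" if "of_nat m \<le> s" "s < \<infinity>" for s
    using \<phi>_strict[OF that] g_strict[OF that] by (auto intro: order.strict_trans2)
  \<comment> \<open>If \<phi> vanished at \<open>s\<close>, it would vanish at both 0 and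
    \<open>m > 0\<close>; then \<open>c = 0\<close>, and the value 0 would have two preimages in the
    range where they are unique.\<close>
  have \<phi>_pos: "\<phi> s > 0" if "of_nat m \<le> s" for s
  proof (rule ccontr)
    assume "\<not> \<phi> s > 0"
    then have 0: "\<phi> (of_nat m) = 0" "\<phi> 0 = 0" using \<phi>_mono[OF that] \<phi>_mono[of 0 s] by auto
    then have "c = 0" by (simp add: c_def)
    then show False using inverse_defined_on_strict_mono[OF inv\<phi> mono_phi, of 0 "of_nat m"] 0 m by simp
  qed
  have g_pos: "g s > 0" if "of_nat m < s" for s
    using g_strict[OF order_refl that] by (rule order.strict_trans1[rotated]) simp

  \<comment> \<open>Real values at the integers and their unbounded growth\<close>
  define G where "G j = enn2real (g (of_nat j))" for j :: nat
  define \<Phi> where "\<Phi> j = enn2real (\<phi> (of_nat (j - s0)))" for j :: nat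
  have G: "ennreal (G j) = g (of_nat j)" if "m \<le> j" for j
    using fin(2)[of "of_nat j"] that by (simp add: G_def of_nat_less_top)
  have \<Phi>: "ennreal (\<Phi> j) = \<phi> (of_nat (j - s0))" if "s1 \<le> j" for j
  proof -
    have "m \<le> j - s0" using that m by simp
    then show ?thesis using fin(1)[of "of_nat (j - s0)"] by (simp add: \<Phi>_def of_nat_less_top)
  qed
  have G_nonneg: "0 \<le> G j" for j by (simp add: G_def)
  have G_strict: "G i < G j" if "m \<le> i" "i < j" for i j
  proof -
    have "g (of_nat i) < g (of_nat j)" using that by (intro g_strict) auto
    then show ?thesis using G[of i] G[of j] G_nonneg[of i] that by (metis ennreal_less_iff le_trans less_imp_le)
  qed
  have G_growth: "2 * K * G (j - s0) \<le> G j" if j: "m + s0 \<le> j" for j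
  proof -
    have "of_nat s1 \<le> (of_nat j :: ennreal)" using j m by simp
    then have "ennreal (2 * K) * g (of_nat j - of_nat s0) \<le> g (of_nat j)"
      using growth unfolding g_def by blast
    also have "of_nat j - of_nat s0 = (of_nat (j - s0) :: ennreal)"
      using j by (simp add: ennreal_of_nat_eq_real_of_nat ennreal_minus of_nat_diff)
    finally have "ennreal (2 * K) * g (of_nat (j - s0)) \<le> g (of_nat j)" .
    moreover have "m \<le> j - s0" "m \<le> j" using j by auto
    ultimately have "ennreal (2 * K * G (j - s0)) \<le> ennreal (G j)"
      unfolding ennreal_mult''[OF G_nonneg] by (simp only: G)
    then show ?thesis using G_nonneg by simp
  qed
  have G_pos: "0 < G j" if "m < j" for j using G_strict[of m j] G_nonneg[of m] that by simp
  \<comment> \<open>Steps of length \<open>s0\<close> at least double \<open>G\<close>, since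
    \<open>K \<ge> 1\<close>.\<close>
  have G_power: "2 ^ k * G s1 \<le> G (s1 + k * s0)" for k
  proof (induction k)
    case (Suc k)
    have "2 ^ Suc k * G s1 \<le> 2 * G (s1 + k * s0)" using Suc by simp
    also have "\<dots> \<le> 2 * K * G (s1 + k * s0)" using K G_nonneg by (intro mult_right_mono) auto
    also have "\<dots> \<le> G (s1 + Suc k * s0)" using G_growth[of "s1 + Suc k * s0"] m by (simp add: algebra_simps)
    finally show ?case .
  qed simp
  have G_unbounded: "\<exists>j\<ge>m. B < G j" for B
  proof -
    \<comment> \<open>If \<open>s0 = 0\<close>, growth at \<open>s1 + 1\<close>, where
      \<open>G\<close> is positive, would force \<open>2 * K \<le> 1\<close>. Positivity of
      \<open>s0\<close> gives \<open>m < s1\<close>, hence \<open>0 < G s1\<close>, which starts the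
      doubling.\<close>
    have "s0 > 0"
    proof (rule ccontr)
      assume "\<not> s0 > 0"
      then have "2 * K * G (s1 + 1) \<le> G (s1 + 1)" "0 < G (s1 + 1)"
        using G_growth[of "s1 + 1"] G_pos[of "s1 + 1"] m by auto
      then have "2 * K \<le> 1" by (simp add: mult_le_cancel_right2)
      then show False using K by simp
    qed
    then have "0 < G s1" using m by (intro G_pos) linarith
    then obtain k where "B / G s1 < 2 ^ k" using real_arch_pow[of 2 "B / G s1"] by auto
    then have "B < G (s1 + k * s0)" using \<open>0 < G s1\<close> G_power[of k] by (simp add: field_simps)
    then show ?thesis using m by (intro exI[of _ "s1 + k * s0"]) auto
  qed

  \<comment> \<open>The series obtained from the convergent integral\<close>
  define \<alpha> where "\<alpha> j = (G (j + 1) / (G j * \<Phi> j)) powr p" for j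
  have p: "p \<ge> 0" using dim by (simp add: p_def)
  have \<Phi>_pos: "0 < \<Phi> j" if "s1 \<le> j" for j
    using \<phi>_pos[of "of_nat (j - s0)"] \<Phi>[OF that] that m ennreal_less_zero_iff[of "\<Phi> j"] by simp
  have quot_pos: "0 < G (j + 1) / (G j * \<Phi> j)" if "s1 < j" for j
    using G_pos[of j] G_pos[of "j + 1"] \<Phi>_pos[of j] that m by simp
  have \<alpha>_pos: "0 < \<alpha> j" if "s1 < j" for j 
    unfolding \<alpha>_def powr_gt_zero using quot_pos[OF that] by linarith
  have \<alpha>_power: "\<alpha> j ^ (CARD('n) - 1) = G (j + 1) / (G j * \<Phi> j)" if "s1 < j" for j
  proof -
    have "\<alpha> j ^ (CARD('n) - 1) = \<alpha> j powr real (CARD('n) - 1)"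
      using powr_realpow[OF \<alpha>_pos[OF that]] by (rule sym)
    also have "\<dots> = (G (j + 1) / (G j * \<Phi> j)) powr (p * real (CARD('n) - 1))"
      by (simp add: \<alpha>_def powr_powr)
    also have "p * real (CARD('n) - 1) = 1" using dim by (simp add: p_def of_nat_diff)
    finally show ?thesis using quot_pos[OF that] by (simp only: powr_one)
  qed
  have "summable \<alpha>"
  proof (rule summable_if_integral_dominates[where k = s1])
    show "(\<integral>\<^sup>+ s\<in>{real s1..}. ennreal_powr
        (g (ennreal (s + 2)) / g (ennreal s) * (1 / \<phi> (ennreal (s - real s0)))) p \<partial>lebesgue) < \<infinity>"
      using int_conv unfolding g_def p_def .
  next
    fix j :: nat and s :: real
    assume j: "s1 < j" and s: "real j - 1 \<le> s" "s < real j"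
    have mj: "real m + 1 \<le> real j" and ms: "real m \<le> s" using j s m by linarith+
    have "ennreal (\<alpha> j) = ennreal_powr (ennreal (G (j + 1) / (G j * \<Phi> j))) p"
      using quot_pos[OF j] by (simp add: \<alpha>_def ennreal_powr_def)
    also have "ennreal (G (j + 1) / (G j * \<Phi> j)) = ennreal (G (j + 1) / G j) * ennreal (1 / \<Phi> j)"
      using G_nonneg[of j] G_nonneg[of "j + 1"] \<Phi>_pos[of j] j by (subst ennreal_mult[symmetric]) auto
    also have "ennreal (G (j + 1) / G j) = g (of_nat (j + 1)) / g (of_nat j)"
      using G[of j] G[of "j + 1"] G_nonneg[of "j + 1"] G_pos[of j] j m by (subst divide_ennreal[symmetric]) auto
    also have "ennreal (1 / \<Phi> j) = 1 / \<phi> (of_nat (j - s0))"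
      using \<Phi>[of j] \<Phi>_pos[of j] j divide_ennreal[of 1 "\<Phi> j"] by simp
    \<comment> \<open>For s in [j - 1, j): \<open>j + 1 \<le> s + 2\<close> in the numerator, and
      \<open>s \<le> j\<close>, \<open>s - s0 \<le> j - s0\<close> in the denominators. This is
      where the shift by 2 in (iii) is used.\<close>
    also have "ennreal_powr (g (of_nat (j + 1)) / g (of_nat j) * (1 / \<phi> (of_nat (j - s0)))) p
        \<le> ennreal_powr (g (ennreal (s + 2)) / g (ennreal s) * (1 / \<phi> (ennreal (s - real s0)))) p"
    proof (intro ennreal_powr_mono p mult_mono ennreal_divide_mono g_mono \<phi>_mono order_refl)
      show "of_nat (j - s0) \<ge> ennreal (s - real s0)"
        unfolding ennreal_of_nat_eq_real_of_nat using s j m by (intro ennreal_leI) (simp add: of_nat_diff)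
    qed (use s j ms mj in \<open>simp_all only: ennreal_of_nat_eq_real_of_nat, auto intro!: ennreal_leI simp del: ennreal_plus\<close>)
    finally show "ennreal (\<alpha> j) \<le> ennreal_powr
        (g (ennreal (s + 2)) / g (ennreal s) * (1 / \<phi> (ennreal (s - real s0)))) p" .
  qed (use \<alpha>_pos in \<open>auto intro: less_imp_le\<close>)

  \<comment> \<open>The local bound, uniform over the family\<close>
  have mv: "sub_mean_value K D (pos_part u)" if "u \<in> \<F>" for u
    using qns[OF that] by (rule quasinearly_subharmonic_imp_sub_mean_value)
  have pos_part_int: "(\<integral>\<^sup>+ y\<in>E. pos_part u y \<partial>lebesgue) < \<infinity>" if "u \<in> \<F>" "compact E" "E \<subseteq> D" for u E
    using qns[OF that(1)] that(2,3) unfolding quasinearly_subharmonic_def locally_integrable_on_def by blast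
  have bound: "\<exists>\<rho>>0. \<exists>C\<ge>0. ball x \<rho> \<subseteq> D \<and> (\<forall>u\<in>\<F>. \<forall>y\<in>ball x \<rho>. pos_part u y \<le> ennreal C)"
    if x: "x \<in> D" for x
  proof -
    obtain e where e: "e > 0" "cball x e \<subseteq> D" using D x by (auto simp: open_contains_cball)
    define \<rho> where "\<rho> = e / 3"
    have \<rho>: "\<rho> > 0" "cball x (3 * \<rho>) \<subseteq> D" using e by (auto simp: \<rho>_def)
    have sub: "cball x (2 * \<rho>) \<subseteq> D" "ball x \<rho> \<subseteq> D" using \<rho> by (auto simp: subset_iff)
    have "(\<integral>\<^sup>+ y\<in>cball x (2 * \<rho>). (\<psi> \<circ> F) y \<partial>lebesgue) < \<infinity>"
      using F_int[OF compact_cball sub(1)] by simp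
    \<comment> \<open>The iteration is applied with \<open>H = \<psi> \<circ> F\<close> and
      \<open>j1 = s1 + 1\<close>, the least index above \<open>m + s0 = s1\<close>.\<close>
    then have "\<exists>j0. \<forall>v. v \<in> borel_measurable (lebesgue_on D) \<longrightarrow> sub_mean_value K D v \<longrightarrow>
        (\<integral>\<^sup>+ y\<in>cball x (3 * \<rho>). v y \<partial>lebesgue) < \<infinity> \<longrightarrow>
        (\<forall>y\<in>cball x (2 * \<rho>). \<forall>j\<ge>s1 + 1. ennreal (G (j - s0)) \<le> v y \<longrightarrow> ennreal (\<Phi> j) \<le> (\<psi> \<circ> F) y) \<longrightarrow>
        (\<forall>y\<in>ball x \<rho>. v y \<le> ennreal (G j0))"
      using K m \<Phi>_pos \<alpha>_pos \<alpha>_power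
      by (intro Domar_iteration[OF dim _ D \<rho> G_strict G_nonneg G_unbounded G_growth _ _ _ _ \<open>summable \<alpha>\<close>]) simp_all
    then obtain j0 where j0: "\<And>v. v \<in> borel_measurable (lebesgue_on D) \<Longrightarrow> sub_mean_value K D v \<Longrightarrow>
        (\<integral>\<^sup>+ y\<in>cball x (3 * \<rho>). v y \<partial>lebesgue) < \<infinity> \<Longrightarrow>
        (\<forall>y\<in>cball x (2 * \<rho>). \<forall>j\<ge>s1 + 1. ennreal (G (j - s0)) \<le> v y \<longrightarrow> ennreal (\<Phi> j) \<le> (\<psi> \<circ> F) y) \<Longrightarrow>
        \<forall>y\<in>ball x \<rho>. v y \<le> ennreal (G j0)"
      by blast
    have "\<forall>y\<in>ball x \<rho>. pos_part u y \<le> ennreal (G j0)" if u: "u \<in> \<F>" for u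
    proof (rule j0[OF _ mv[OF u] pos_part_int[OF u compact_cball \<rho>(2)]])
      show "pos_part u \<in> borel_measurable (lebesgue_on D)"
        using qns[OF u] by (intro pos_part_borel_measurable) (simp add: quasinearly_subharmonic_def)
      show "\<forall>y\<in>cball x (2 * \<rho>). \<forall>j\<ge>s1 + 1. ennreal (G (j - s0)) \<le> pos_part u y \<longrightarrow> ennreal (\<Phi> j) \<le> (\<psi> \<circ> F) y"
      proof (intro ballI allI impI)
        fix y j
        assume y: "y \<in> cball x (2 * \<rho>)" and j: "s1 + 1 \<le> j" and le: "ennreal (G (j - s0)) \<le> pos_part u y"
        have jm: "m \<le> j - s0" using j m by simp
        \<comment> \<open>Applying \<psi> to g(j - s0) \<le> \<open>F y\<close> gives \<phi>(j - s0)
          \<le> \<psi>(\<open>F y\<close>). This is the only use of the majorant, and the resulting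
          bound is the same for all \<open>u\<close>.\<close>
        have "pos_part u y \<le> F y" using y sub dominated[OF u] by (intro pos_part_le) auto
        then have "g (of_nat (j - s0)) \<le> F y" using le G[OF jm] by simp
        then have "\<psi> (g (of_nat (j - s0))) \<le> \<psi> (F y)" by (rule monoD[OF mono_psi])
        then show "ennreal (\<Phi> j) \<le> (\<psi> \<circ> F) y" using \<psi>_g[of "of_nat (j - s0)"] jm j \<Phi>[of j] by simp
      qed
    qed
    then show ?thesis using \<rho>(1) sub(2) G_nonneg by blast
  qed

  \<comment> \<open>Finiteness and quasinear subharmonicity of the regularization\<close>
  have usc_fin: "usc_regularization D w x < \<infinity>" if x: "x \<in> D" for x
  proof -
    obtain \<rho> C where \<rho>: "\<rho> > 0" "\<And>u y. u \<in> \<F> \<Longrightarrow> y \<in> ball x \<rho> \<Longrightarrow> pos_part u y \<le> ennreal C"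
      using bound[OF x] by blast
    have "usc_regularization D w x \<le> ennreal C"
      by (rule usc_regularization_le[of "ball x \<rho>"]) (use \<rho> in \<open>auto simp: w_eq intro!: SUP_least\<close>)
    also have "\<dots> < \<infinity>" by simp
    finally show ?thesis .
  qed
  have "locally_uniformly_bounded D \<F>"
    unfolding locally_uniformly_bounded_def
  proof
    fix x assume "x \<in> D"
    then obtain \<rho> C where "\<rho> > 0" "C \<ge> 0" "ball x \<rho> \<subseteq> D" "\<forall>u\<in>\<F>. \<forall>y\<in>ball x \<rho>. pos_part u y \<le> ennreal C"
      using bound by blast
    then show "\<exists>r>0. \<exists>C::real. ball x r \<subseteq> D \<and> (\<forall>u\<in>\<F>. \<forall>y\<in>ball x r. u y \<le> ereal C)"
      by (intro exI[of _ \<rho>] exI[of _ C] conjI ballI le_pos_partD) auto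
  qed
  moreover have "quasinearly_subharmonic K D (\<lambda>x. enn2ereal (usc_regularization D w x))"
  proof (rule quasinearly_subharmonic_enn2ereal[OF D K usc_fin usc_regularization_borel_measurable[OF D]])
    show "sub_mean_value K D (usc_regularization D w)"
      by (rule sub_mean_value_usc_regularization[of K "pos_part ` \<F>"]) (use K mv w_eq in \<open>auto simp: image_image\<close>)
    fix E assume E: "compact E" "E \<subseteq> D"
    obtain n :: nat where n: "\<And>x. x \<in> E \<Longrightarrow> usc_regularization D w x \<le> of_nat n"
      using usc_regularization_bounded_on_compact[OF D E usc_fin] by blast
    have "(\<integral>\<^sup>+ x\<in>E. usc_regularization D w x \<partial>lebesgue) \<le> (\<integral>\<^sup>+ x. of_nat n * indicator E x \<partial>lebesgue)"
      using n by (intro nn_integral_mono) (auto simp: indicator_def)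
    also have "\<dots> = of_nat n * emeasure lebesgue E"
      using E by (intro nn_integral_cmult_indicator) (auto simp: fmeasurableD lmeasurable_compact)
    also have "\<dots> < \<infinity>"
      using fmeasurableD2[OF lmeasurable_compact[OF E(1)]] by (simp add: ennreal_mult_less_top less_top of_nat_less_top)
    finally show "(\<integral>\<^sup>+ x\<in>E. usc_regularization D w x \<partial>lebesgue) < \<infinity>" .
  qed
  ultimately show ?thesis using usc_fin by blast
qed

end
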